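(* Let $\mathcal{D}$ be a universe of random sets in a Banach space $X$ and let $\varphi$ be a quasi-$\tau$-continuous random dynamical system on $X$, where $\tau$ is a Hausdorff topology on $X$ that is weaker than the norm topology. Then $\varphi$ has a $\mathcal{D}$-random attractor if and only if: (i) $\varphi$ has a bounded $\mathcal{D}$-attracting random set $F\in\mathcal{D}$; and (ii) $\varphi$ is $\mathcal{D}$-asymptotically compact in $X$.
   Context: Metric dynamical system: $((\Omega,\mathcal{F},\mathbb{P}),(\theta_t)_{t\in\mathbb{R}})$ with $(\Omega,\mathcal{F},\mathbb{P})$ a probability space, $(t,\omega)\mapsto\theta_t\omega$ measurable, $\theta_0=\mathrm{id}$, $\theta_{t+s}=\theta_t\circ\theta_s$, $\theta_t$ $\mathbb{P}$-preserving. It is fixed throughout. A random dynamical system (RDS) on a complete separable metric space $(X,d)$ is a measurable map $\varphi:\mathbb{R}_+\times X\times\Omega\to X$ with $\varphi(0,\omega)=\mathrm{id}$ and $\varphi(t+s,\omega)=\varphi(t,\theta_s\omega)\circ\varphi(s,\omega)$ for all $s,t\in\mathbb{R}_+$, $\omega\in\Omega$. An RDS on a Banach space $X$ endowed with a topology $\tau$ is quasi-$\tau$-continuous if, for each $\omega$, $\varphi(t_n,\omega)x_n\to\varphi(t,\omega)x$ in $\tau$ whenever $(t_n,x_n)\in\mathbb{R}_+\times X$, $\varphi(t_n,\omega)x_n$ is bounded and $(t_n,x_n)\to(t,x)$ (with norm convergence $x_n\to x$). For nonempty $A,B\subseteq X$: $d(A,B)=\sup_{x\in A}\inf_{y\in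 B}d(x,y)$. A random (closed) set is a map $D:\Omega\to2^X$ with closed values such that $\omega\mapsto d(x,D(\omega))$ is measurable for each $x\in X$. A universe of random sets $\mathcal{D}$ is a collection of random closed sets such that if $D\in\mathcal{D}$ and $\hat D$ is a random closed set with $\hat D(\omega)\subseteq D(\omega)$ for all $\omega$, then $\hat D\in\mathcal{D}$. A random set $F$ is bounded if $F(\omega)$ is bounded for each $\omega$. $A$ attracts $B$ if $d(\varphi(t,\theta_{-t}\omega)B(\theta_{-t}\omega),A(\omega))\to0$ as $t\to\infty$ for all $\omega\in\Omega$. A set in $\mathcal{D}$ is $\mathcal{D}$-attracting if it attracts every set in $\mathcal{D}$. $\varphi$ is $\mathcal{D}$-asymptotically compact in $X$ if $\varphi(t_n,\theta_{-t_n}\omega)x_n$ has a convergent subsequence in $X$ for all $\omega\in\Omega$, $t_n\to\infty$, $x_n\in D(\theta_{-t_n}\omega)$, $D\in\mathcal{D}$. A $\mathcal{D}$-random attractor is a compact random set $A\in\mathcal{D}$ (compact values) which is invariant, i.e. $\varphi(t,\omega)A(\omega)=A(\theta_t\omega)$ for all $t>0$, and $\mathcal{D}$-attracting. *)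

theory Defs
  imports "HOL-Probability.Probability"
begin

text \<open>The sample space \<open>\<Omega>\<close> is \<^term>\<open>space M\<close>; conditions on sample points are imposed there
  only, and values outside it are irrelevant.\<close>

locale metric_dynamical_system = prob_space M
  for M :: "'w measure" +
  fixes \<theta> :: "real \<Rightarrow> 'w \<Rightarrow> 'w"
  assumes flow_measurable: "(\<lambda>(t, \<omega>). \<theta> t \<omega>) \<in> borel \<Otimes>\<^sub>M M \<rightarrow>\<^sub>M M"
    and flow_zero: "\<And>\<omega>. \<omega> \<in> space M \<Longrightarrow> \<theta> 0 \<omega> = \<omega>"
    and flow_add: "\<And>t s \<omega>. \<omega> \<in> space M \<Longrightarrow> \<theta> (t + s) \<omega> = \<theta> t (\<theta> s \<omega>)"
    and flow_preserving: "\<And>t. distr M M (\<theta> t) = M"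

text \<open>The map \<open>\<phi>(t,\<omega>)x\<close> is written \<open>\<phi> t \<omega> x\<close>; its values for \<open>t < 0\<close> are irrelevant.\<close>

locale random_dynamical_system = metric_dynamical_system M \<theta>
  for M :: "'w measure" and \<theta> :: "real \<Rightarrow> 'w \<Rightarrow> 'w" +
  fixes \<phi> :: "real \<Rightarrow> 'w \<Rightarrow> 'x::polish_space \<Rightarrow> 'x"
  assumes cocycle_measurable:
      "(\<lambda>(t, x, \<omega>). \<phi> t \<omega> x) \<in> restrict_space borel {0..} \<Otimes>\<^sub>M borel \<Otimes>\<^sub>M M \<rightarrow>\<^sub>M borel"
    and cocycle_zero: "\<And>\<omega> x. \<omega> \<in> space M \<Longrightarrow> \<phi> 0 \<omega> x = x"
    and cocycle_add: "\<And>s t \<omega> x. 0 \<le> s \<Longrightarrow> 0 \<le> t \<Longrightarrow> \<omega> \<in> space M \<Longrightarrow>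
      \<phi> (t + s) \<omega> x = \<phi> t (\<theta> s \<omega>) (\<phi> s \<omega> x)"

definition quasi_continuous ::
  "'w measure \<Rightarrow> 'x::real_normed_vector topology \<Rightarrow> (real \<Rightarrow> 'w \<Rightarrow> 'x \<Rightarrow> 'x) \<Rightarrow> bool"
where
  "quasi_continuous M \<tau> \<phi> \<longleftrightarrow>
    (\<forall>\<omega>\<in>space M. \<forall>(s :: nat \<Rightarrow> real) (y :: nat \<Rightarrow> 'x) t x.
      (\<forall>n. 0 \<le> s n) \<longrightarrow> bounded (range (\<lambda>n. \<phi> (s n) \<omega> (y n))) \<longrightarrow>
      s \<longlonglongrightarrow> t \<longrightarrow> y \<longlonglongrightarrow> x \<longrightarrow>
      limitin \<tau> (\<lambda>n. \<phi> (s n) \<omega> (y n)) (\<phi> t \<omega> x) sequentially)"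

text \<open>Extended-real valued, as the supremum need not be finite; meant for nonempty sets
  (\<^term>\<open>infdist x {}\<close> is \<open>0\<close> by convention).\<close>

definition semidist :: "'x::metric_space set \<Rightarrow> 'x set \<Rightarrow> ereal" where
  "semidist A B = (SUP x\<in>A. ereal (infdist x B))"

text \<open>Random sets have nonempty values, so that the distances to them are defined.\<close>

definition random_set :: "'w measure \<Rightarrow> ('w \<Rightarrow> 'x::metric_space set) \<Rightarrow> bool" where
  "random_set M D \<longleftrightarrow>
    (\<forall>\<omega>\<in>space M. closed (D \<omega>) \<and> D \<omega> \<noteq> {}) \<and>
    (\<forall>x. (\<lambda>\<omega>. infdist x (D \<omega>)) \<in> borel_measurable M)"

definition random_universe :: "'w measure \<Rightarrow> ('w \<Rightarrow> 'x::metric_space set) set \<Rightarrow> bool" where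
  "random_universe M \<D> \<longleftrightarrow>
    (\<forall>D\<in>\<D>. random_set M D) \<and>
    (\<forall>D\<in>\<D>. \<forall>D'. random_set M D' \<longrightarrow> (\<forall>\<omega>\<in>space M. D' \<omega> \<subseteq> D \<omega>) \<longrightarrow> D' \<in> \<D>)"

definition bounded_random_set :: "'w measure \<Rightarrow> ('w \<Rightarrow> 'x::metric_space set) \<Rightarrow> bool" where
  "bounded_random_set M F \<longleftrightarrow> random_set M F \<and> (\<forall>\<omega>\<in>space M. bounded (F \<omega>))"

definition compact_random_set :: "'w measure \<Rightarrow> ('w \<Rightarrow> 'x::metric_space set) \<Rightarrow> bool" where
  "compact_random_set M A \<longleftrightarrow> random_set M A \<and> (\<forall>\<omega>\<in>space M. compact (A \<omega>))"

definition attracts ::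
  "'w measure \<Rightarrow> (real \<Rightarrow> 'w \<Rightarrow> 'w) \<Rightarrow> (real \<Rightarrow> 'w \<Rightarrow> 'x::metric_space \<Rightarrow> 'x) \<Rightarrow>
    ('w \<Rightarrow> 'x set) \<Rightarrow> ('w \<Rightarrow> 'x set) \<Rightarrow> bool"
where
  "attracts M \<theta> \<phi> A B \<longleftrightarrow>
    (\<forall>\<omega>\<in>space M.
      ((\<lambda>t. semidist (\<phi> t (\<theta> (- t) \<omega>) ` B (\<theta> (- t) \<omega>)) (A \<omega>)) \<longlongrightarrow> 0) at_top)"

definition universe_attracting ::
  "'w measure \<Rightarrow> (real \<Rightarrow> 'w \<Rightarrow> 'w) \<Rightarrow> (real \<Rightarrow> 'w \<Rightarrow> 'x::metric_space \<Rightarrow> 'x) \<Rightarrow>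
    ('w \<Rightarrow> 'x set) set \<Rightarrow> ('w \<Rightarrow> 'x set) \<Rightarrow> bool"
where
  "universe_attracting M \<theta> \<phi> \<D> A \<longleftrightarrow> A \<in> \<D> \<and> (\<forall>B\<in>\<D>. attracts M \<theta> \<phi> A B)"

definition asymptotically_compact ::
  "'w measure \<Rightarrow> (real \<Rightarrow> 'w \<Rightarrow> 'w) \<Rightarrow> (real \<Rightarrow> 'w \<Rightarrow> 'x::metric_space \<Rightarrow> 'x) \<Rightarrow>
    ('w \<Rightarrow> 'x set) set \<Rightarrow> bool"
where
  "asymptotically_compact M \<theta> \<phi> \<D> \<longleftrightarrow>
    (\<forall>\<omega>\<in>space M. \<forall>D\<in>\<D>. \<forall>(t :: nat \<Rightarrow> real) (x :: nat \<Rightarrow> 'x).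
      (\<forall>n. 0 \<le> t n) \<longrightarrow> filterlim t at_top sequentially \<longrightarrow>
      (\<forall>n. x n \<in> D (\<theta> (- t n) \<omega>)) \<longrightarrow>
      (\<exists>r. strict_mono r \<and> convergent ((\<lambda>n. \<phi> (t n) (\<theta> (- t n) \<omega>) (x n)) \<circ> r)))"

definition random_attractor ::
  "'w measure \<Rightarrow> (real \<Rightarrow> 'w \<Rightarrow> 'w) \<Rightarrow> (real \<Rightarrow> 'w \<Rightarrow> 'x::metric_space \<Rightarrow> 'x) \<Rightarrow>
    ('w \<Rightarrow> 'x set) set \<Rightarrow> ('w \<Rightarrow> 'x set) \<Rightarrow> bool"
where
  "random_attractor M \<theta> \<phi> \<D> A \<longleftrightarrow>
    compact_random_set M A \<and> A \<in> \<D> \<and>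
    (\<forall>\<omega>\<in>space M. \<forall>t>0. \<phi> t \<omega> ` A \<omega> = A (\<theta> t \<omega>)) \<and>
    universe_attracting M \<theta> \<phi> \<D> A"

end

theory Submission
  imports Defs
begin

text \<open>
  A compact set that attracts \<open>\<D>\<close> forces asymptotic compactness, since orbits that approach a
  compact set have convergent subsequences. For the converse the attractor is the pullback
  omega-limit set \<open>A\<close> of the attracting set \<open>F\<close>. Three points need an argument.

  \<^bold>\<open>Invariance.\<close> The maps \<open>\<phi> t \<omega>\<close> need not be norm continuous, but their graphs are closed for
  norm convergence on both sides: a norm convergent sequence of images is bounded, so it also
  converges in \<open>\<tau>\<close> to the image of the limit, and \<open>\<tau>\<close> is Hausdorff
  (\<open>cocycle_closed_graph\<close>). Asymptotic compactness supplies the norm convergent subsequences that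
  this needs, and the usual proof of invariance goes through (\<open>limit_set_invariant\<close>).

  \<^bold>\<open>Attraction.\<close> Every member \<open>D\<close> of the universe is attracted by its own omega-limit set, which
  is invariant and contained in the closed attracting set \<open>F\<close>. By invariance each of its points
  is reached from \<open>F\<close> after arbitrarily long pullback times, so the omega-limit set of \<open>D\<close> is
  contained in \<open>A\<close>.

  \<^bold>\<open>Measurability.\<close> Images of \<open>F\<close> under the cocycle are not known to be measurable, and a dense
  subset of \<open>F\<close> need not have a dense image. Nevertheless a countable dense family \<open>f k\<close> of
  measurable selections of \<open>F\<close> determines \<open>A\<close>: the points reached from these selections after
  integer times accumulate in norm at every point of \<open>A\<close>
  (\<open>limit_set_approx_by_selections\<close>). By quasi-continuity they come \<open>\<tau>\<close>-close to any given point
  \<open>a\<close> of \<open>A\<close>; asymptotic compactness makes them accumulate in norm somewhere on \<open>A\<close>; and a compact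
  part of \<open>A\<close> that avoids \<open>a\<close> can be separated from \<open>a\<close> by \<open>\<tau>\<close>-open sets. Hence the distance to
  \<open>A\<close> is the lower limit of a sequence of countable infima of measurable functions
  (\<open>random_set_limit_set\<close>).
\<close>

section \<open>Limit sets of families of sets\<close>

text \<open>This is the upper limit \<open>\<Inter>s. closure (\<Union>t\<ge>s. S t)\<close>; the omega-limit sets below are the limit
  sets of pullback images.\<close>

definition limit_set :: "(real \<Rightarrow> 'a::metric_space set) \<Rightarrow> 'a set" where
  "limit_set S = {y. \<forall>e>0. \<exists>\<^sub>F t in at_top. \<exists>z\<in>S t. dist z y < e}"

definition asymptotically_precompact :: "(real \<Rightarrow> 'a::metric_space set) \<Rightarrow> bool" where
  "asymptotically_precompact S \<longleftrightarrow>
    (\<forall>(t :: nat \<Rightarrow> real) z. (\<forall>n. 0 \<le> t n) \<longrightarrow> filterlim t at_top sequentially \<longrightarrow>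
      (\<forall>n. z n \<in> S (t n)) \<longrightarrow> (\<exists>r. strict_mono r \<and> convergent (z \<circ> r)))"

lemma filterlim_at_top_ge_real:
  fixes t :: "nat \<Rightarrow> real"
  assumes "\<And>n. real n \<le> t n"
  shows "filterlim t at_top sequentially"
  by (rule filterlim_at_top_mono[OF filterlim_real_sequentially]) (simp add: assms)

lemma limit_setI:
  assumes "filterlim t at_top sequentially" and "\<And>n::nat. z n \<in> S (t n)" and "z \<longlonglongrightarrow> y"
  shows "y \<in> limit_set S"
  unfolding limit_set_def
proof (intro CollectI allI impI)
  fix e :: real assume "e > 0"
  have "\<exists>t'\<ge>N. \<exists>z\<in>S t'. dist z y < e" for N
  proof -
    have "\<forall>\<^sub>F n in sequentially. N \<le> t n \<and> dist (z n) y < e"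
      using assms(1) tendstoD[OF assms(3) \<open>e > 0\<close>]
      unfolding filterlim_at_top by (intro eventually_conj) blast+
    then obtain n where "N \<le> t n \<and> dist (z n) y < e"
      using eventually_happens' sequentially_bot by blast
    with assms(2) show ?thesis by blast
  qed
  then show "\<exists>\<^sub>F t in at_top. \<exists>z\<in>S t. dist z y < e"
    unfolding frequently_def eventually_at_top_linorder by meson
qed

lemma limit_set_approx:
  assumes "y \<in> limit_set S" and "e > 0"
  shows "\<exists>t z. N \<le> t \<and> z \<in> S t \<and> dist z y < e"
proof -
  have "\<exists>\<^sub>F t in at_top. \<exists>z\<in>S t. dist z y < e" using assms unfolding limit_set_def by blast
  then have "\<exists>t\<ge>N. \<exists>z\<in>S t. dist z y < e"
    by (simp add: frequently_def eventually_at_top_linorder)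
  then show ?thesis by blast
qed

lemma limit_setE:
  assumes "y \<in> limit_set S"
  obtains t z where "\<And>n. real n \<le> t n" and "\<And>n::nat. z n \<in> S (t n)" and "z \<longlonglongrightarrow> y"
proof -
  have "\<exists>t z. real n \<le> t \<and> z \<in> S t \<and> dist z y < 1 / real (Suc n)" for n
    using assms by (intro limit_set_approx) auto
  then obtain t z where tz: "\<And>n. real n \<le> t n \<and> z n \<in> S (t n) \<and> dist (z n) y < 1 / real (Suc n)"
    by metis
  have "(\<lambda>n. dist (z n) y) \<longlonglongrightarrow> 0"
    by (rule tendsto_sandwich[OF _ _ tendsto_const LIMSEQ_Suc[OF lim_1_over_n]])
       (use tz in \<open>auto intro!: always_eventually less_imp_le\<close>)
  then have "z \<longlonglongrightarrow> y" by (rule tendsto_dist_iff[THEN iffD2])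
  show thesis by (rule that[of t z, OF _ _ \<open>z \<longlonglongrightarrow> y\<close>]) (use tz in blast)+
qed

lemma tendsto_of_asymptotic_dist:
  assumes "z \<longlonglongrightarrow> l" and "(\<lambda>n. dist (f n) (z n)) \<longlonglongrightarrow> 0"
  shows "f \<longlonglongrightarrow> l"
proof -
  have "(\<lambda>n. dist (f n) (z n) + dist (z n) l) \<longlonglongrightarrow> 0"
    using assms tendsto_add_zero tendsto_dist_iff by blast
  from tendsto_sandwich[OF _ _ tendsto_const this, of "\<lambda>n. dist (f n) l"]
  have "(\<lambda>n. dist (f n) l) \<longlonglongrightarrow> 0" by (simp add: dist_triangle)
  then show ?thesis by (rule tendsto_dist_iff[THEN iffD2])
qed

lemma closed_limit_set: "closed (limit_set S)"
  unfolding closed_limpt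
proof (intro allI impI)
  fix y assume "y islimpt limit_set S"
  then have y: "\<exists>x\<in>limit_set S. dist x y < e" if "e > 0" for e
    using that by (auto simp: islimpt_approachable)
  show "y \<in> limit_set S"
    unfolding limit_set_def
  proof (intro CollectI allI impI)
    fix e :: real assume "e > 0"
    then obtain x where x: "x \<in> limit_set S" "dist x y < e / 2" using y[of "e / 2"] by auto
    then have "\<exists>\<^sub>F t in at_top. \<exists>z\<in>S t. dist z x < e / 2"
      using half_gt_zero[OF \<open>e > 0\<close>] unfolding limit_set_def by blast
    then show "\<exists>\<^sub>F t in at_top. \<exists>z\<in>S t. dist z y < e"
    proof (rule frequently_elim1)
      fix t assume "\<exists>z\<in>S t. dist z x < e / 2"
      then obtain z where z: "z \<in> S t" "dist z x < e / 2" by blast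
      have "dist z y < e" using z(2) x(2) dist_triangle[of z y x] by linarith
      with z(1) show "\<exists>z\<in>S t. dist z y < e" by blast
    qed
  qed
qed

lemma asymptotically_precompactE:
  assumes "asymptotically_precompact S" and "\<And>n. real n \<le> t n" and "\<And>n. z n \<in> S (t n)"
  obtains r l where "strict_mono r" and "(\<lambda>n. z (r n)) \<longlonglongrightarrow> l" and "l \<in> limit_set S"
    and "filterlim (\<lambda>n. t (r n)) at_top sequentially"
proof -
  have lim: "filterlim t at_top sequentially" by (rule filterlim_at_top_ge_real[OF assms(2)])
  have "0 \<le> t n" for n using assms(2)[of n] by linarith
  then obtain r l where r: "strict_mono r" "(\<lambda>n. z (r n)) \<longlonglongrightarrow> l"
    using assms(1)[unfolded asymptotically_precompact_def, rule_format, of t z] assms(3) lim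
    by (auto simp: convergent_def o_def)
  moreover have tr: "filterlim (\<lambda>n. t (r n)) at_top sequentially"
    by (rule filterlim_compose[OF lim filterlim_subseq[OF r(1)]])
  moreover have "l \<in> limit_set S"
    by (rule limit_setI[OF tr _ r(2)]) (rule assms(3))
  ultimately show thesis using that by blast
qed

text \<open>A sequence in the limit set is shadowed by points of the sets \<open>S t\<close> at increasing times, with
  errors tending to \<open>0\<close>, so it inherits convergent subsequences from the family.\<close>

lemma compact_limit_set:
  assumes "asymptotically_precompact S"
  shows "compact (limit_set S)"
  unfolding compact_def
proof (intro allI impI)
  fix f :: "nat \<Rightarrow> 'a" assume f: "\<forall>n. f n \<in> limit_set S"
  have "\<exists>t z. real n \<le> t \<and> z \<in> S t \<and> dist z (f n) < 1 / real (Suc n)" for n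
    using f by (intro limit_set_approx) auto
  then obtain t z where tz: "\<And>n. real n \<le> t n \<and> z n \<in> S (t n) \<and> dist (z n) (f n) < 1 / real (Suc n)"
    by metis
  obtain r l where r: "strict_mono r" "(\<lambda>n. z (r n)) \<longlonglongrightarrow> l" "l \<in> limit_set S"
    using asymptotically_precompactE[OF assms, of t z] tz by metis
  have "(\<lambda>n. dist (f n) (z n)) \<longlonglongrightarrow> 0"
    by (rule tendsto_sandwich[OF _ _ tendsto_const LIMSEQ_Suc[OF lim_1_over_n]])
       (use tz in \<open>auto intro!: always_eventually less_imp_le simp: dist_commute\<close>)
  then have "(\<lambda>n. dist (f (r n)) (z (r n))) \<longlonglongrightarrow> 0"
    using LIMSEQ_subseq_LIMSEQ[OF _ r(1)] by (fastforce simp: o_def)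
  then have "(f \<circ> r) \<longlonglongrightarrow> l"
    using tendsto_of_asymptotic_dist[OF r(2), of "f \<circ> r"] by simp
  with r show "\<exists>l\<in>limit_set S. \<exists>r. strict_mono r \<and> (f \<circ> r) \<longlonglongrightarrow> l" by blast
qed

lemma limit_set_nonempty:
  assumes "asymptotically_precompact S" and "\<And>t. S t \<noteq> {}"
  shows "limit_set S \<noteq> {}"
proof -
  have "\<exists>z. z \<in> S (real n)" for n using assms(2)[of "real n"] by blast
  then obtain z where "\<And>n::nat. z n \<in> S (real n)" by metis
  then show ?thesis
    using asymptotically_precompactE[OF assms(1), of real z] by auto
qed

lemma semidist_tendsto_0D:
  assumes "((\<lambda>t. semidist (S t) C) \<longlongrightarrow> 0) F" and "e > 0"
  shows "\<forall>\<^sub>F t in F. \<forall>z\<in>S t. infdist z C < e"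
proof -
  have "\<forall>\<^sub>F t in F. semidist (S t) C < ereal e"
    using order_tendstoD(2)[OF assms(1)] assms(2) by simp
  then show ?thesis
  proof (rule eventually_mono)
    fix t assume "semidist (S t) C < ereal e"
    then show "\<forall>z\<in>S t. infdist z C < e"
      unfolding semidist_def by (metis SUP_lessD less_ereal.simps(1))
  qed
qed

text \<open>Otherwise points of the sets \<open>S t\<close> at arbitrarily late times would stay at a fixed distance
  from \<open>C\<close>, and so would one of their accumulation points, which lies in the limit set. The sets
  must be nonempty because the supremum over the empty set is \<open>-\<infinity>\<close>.\<close>

lemma semidist_tendsto_0I:
  fixes S :: "real \<Rightarrow> 'a::metric_space set"
  assumes "asymptotically_precompact S" and "limit_set S \<subseteq> C" and "\<And>t. S t \<noteq> {}"
  shows "((\<lambda>t. semidist (S t) C) \<longlongrightarrow> 0) at_top"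
proof (rule order_tendstoI)
  fix a :: ereal assume "a < 0"
  have "0 \<le> semidist (S t) C" for t
  proof -
    obtain z where "z \<in> S t" using assms(3) by blast
    then show ?thesis unfolding semidist_def
      by (intro SUP_upper2[of z]) (auto simp: infdist_nonneg)
  qed
  with \<open>a < 0\<close> show "\<forall>\<^sub>F t in at_top. a < semidist (S t) C"
    by (intro always_eventually) (meson less_le_trans)
next
  fix a :: ereal assume "0 < a"
  then obtain e where e: "0 < ereal e" "ereal e < a" using ereal_dense2 by blast
  have "\<forall>\<^sub>F t in at_top. \<forall>z\<in>S t. infdist z C < e"
  proof (rule ccontr)
    assume "\<not> ?thesis"
    then have "\<exists>t\<ge>real n. \<exists>z\<in>S t. e \<le> infdist z C" for n :: nat
      by (simp add: eventually_at_top_linorder not_less)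
    then obtain t z where tz: "\<And>n. real n \<le> t n \<and> z n \<in> S (t n) \<and> e \<le> infdist (z n) C"
      by metis
    obtain r l where r: "(\<lambda>n. z (r n)) \<longlonglongrightarrow> l" "l \<in> limit_set S"
      using asymptotically_precompactE[OF assms(1), of t z] tz by metis
    then have "l \<in> C" using assms(2) by blast
    have "\<forall>\<^sub>F n in sequentially. dist (z (r n)) l < e" using tendstoD[OF r(1)] e(1) by simp
    then obtain n where "dist (z (r n)) l < e"
      using eventually_happens' sequentially_bot by blast
    moreover have "infdist (z (r n)) C \<le> dist (z (r n)) l" by (rule infdist_le[OF \<open>l \<in> C\<close>])
    ultimately show False using tz[of "r n"] by linarith
  qed
  then show "\<forall>\<^sub>F t in at_top. semidist (S t) C < a"
  proof (rule eventually_mono)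
    fix t assume "\<forall>z\<in>S t. infdist z C < e"
    then have "semidist (S t) C \<le> ereal e"
      unfolding semidist_def by (intro SUP_least) (auto intro: less_imp_le)
    with e(2) show "semidist (S t) C < a" by simp
  qed
qed

lemma limit_set_subset_attracting:
  assumes "((\<lambda>t. semidist (S t) C) \<longlongrightarrow> 0) at_top" and "closed C" and "C \<noteq> {}"
  shows "limit_set S \<subseteq> C"
proof
  fix y assume "y \<in> limit_set S"
  have "infdist y C \<le> e" if "e > 0" for e
  proof -
    have "\<exists>\<^sub>F t in at_top. \<exists>z\<in>S t. dist z y < e / 2"
      using \<open>y \<in> limit_set S\<close> half_gt_zero[OF that] unfolding limit_set_def by blast
    moreover have "\<forall>\<^sub>F t in at_top. \<forall>z\<in>S t. infdist z C < e / 2"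
      by (rule semidist_tendsto_0D[OF assms(1) half_gt_zero[OF that]])
    ultimately have "\<exists>\<^sub>F t in at_top. (\<forall>z\<in>S t. infdist z C < e / 2) \<and> (\<exists>z\<in>S t. dist z y < e / 2)"
      by (rule frequently_eventually_conj)
    then obtain z where "dist z y < e / 2" "infdist z C < e / 2"
      using frequently_ex by blast
    moreover have "infdist y C \<le> infdist z C + dist y z" by (rule infdist_triangle)
    ultimately show ?thesis by (simp add: dist_commute)
  qed
  then have "infdist y C = 0" by (meson dense_ge eq_iff infdist_nonneg)
  then show "y \<in> C" using assms by (simp add: in_closed_iff_infdist_zero)
qed

lemma compact_nearest_point:
  assumes "compact C" and "C \<noteq> {}"
  shows "\<exists>c\<in>C. infdist x C = dist x c"
proof -
  have "continuous_on C (dist x)" by (intro continuous_intros)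
  then obtain c where c: "c \<in> C" "\<And>y. y \<in> C \<Longrightarrow> dist x c \<le> dist x y"
    using continuous_attains_inf[OF assms] by blast
  then have "dist x c \<le> infdist x C"
    using assms(2) by (simp add: infdist_notempty cINF_greatest)
  with infdist_le[OF c(1), of x] c(1) show ?thesis by (intro bexI[of _ c]) auto
qed

lemma eventually_bounded_of_attracting:
  assumes "((\<lambda>t. semidist (S t) C) \<longlongrightarrow> 0) F" and "bounded C" and "C \<noteq> {}"
  shows "\<forall>\<^sub>F t in F. bounded (S t)"
proof -
  obtain x R where R: "\<And>y. y \<in> C \<Longrightarrow> dist x y \<le> R" using assms(2) by (auto simp: bounded_def)
  have "\<forall>\<^sub>F t in F. \<forall>z\<in>S t. infdist z C < 1"
    by (rule semidist_tendsto_0D[OF assms(1)]) simp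
  then show ?thesis
  proof (rule eventually_mono)
    fix t assume near: "\<forall>z\<in>S t. infdist z C < 1"
    have "dist x z \<le> R + 1" if "z \<in> S t" for z
    proof -
      obtain c where "c \<in> C" "dist z c < 1"
        using near[rule_format, OF \<open>z \<in> S t\<close>] assms(3) by (auto simp: infdist_notempty cINF_less_iff)
      then show ?thesis using R[of c] dist_triangle2[of x z c] by linarith
    qed
    then show "bounded (S t)" unfolding bounded_def by blast
  qed
qed

text \<open>Nearest points in \<open>C\<close> shadow any sequence taken at times tending to infinity.\<close>

lemma asymptotically_precompact_of_compact_attracting:
  assumes "((\<lambda>t. semidist (S t) C) \<longlongrightarrow> 0) at_top" and "compact C" and "C \<noteq> {}"
  shows "asymptotically_precompact S"
  unfolding asymptotically_precompact_def
proof (intro allI impI)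
  fix t :: "nat \<Rightarrow> real" and z
  assume t: "filterlim t at_top sequentially" and z: "\<forall>n. z n \<in> S (t n)"
  have "\<exists>x\<in>C. infdist (z n) C = dist (z n) x" for n
    by (rule compact_nearest_point[OF assms(2,3)])
  then obtain c where c: "\<And>n. c n \<in> C" "\<And>n. infdist (z n) C = dist (z n) (c n)" by metis
  have zc: "(\<lambda>n. dist (z n) (c n)) \<longlonglongrightarrow> 0"
  proof (rule order_tendstoI)
    fix a :: real assume "0 < a"
    have "\<forall>\<^sub>F n in sequentially. \<forall>z\<in>S (t n). infdist z C < a"
      using semidist_tendsto_0D[OF assms(1) \<open>0 < a\<close>] t by (rule eventually_compose_filterlim)
    then show "\<forall>\<^sub>F n in sequentially. dist (z n) (c n) < a"
      by (rule eventually_mono) (use z in \<open>simp add: c(2)[symmetric]\<close>)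
  qed (auto intro!: always_eventually intro: less_le_trans)
  obtain l r where r: "strict_mono r" "(c \<circ> r) \<longlonglongrightarrow> l"
    using assms(2)[unfolded compact_def, rule_format, of c] c(1) by blast
  have "(z \<circ> r) \<longlonglongrightarrow> l"
    using LIMSEQ_subseq_LIMSEQ[OF zc r(1)]
    by (intro tendsto_of_asymptotic_dist[OF r(2)]) (simp add: o_def)
  then show "\<exists>r. strict_mono r \<and> convergent (z \<circ> r)" using r(1) by (auto simp: convergent_def)
qed

section \<open>Measurable selections\<close>

lemma dense_sequence_exists:
  "\<exists>q :: nat \<Rightarrow> 'x::polish_space. \<forall>y e. e > 0 \<longrightarrow> (\<exists>i. dist (q i) y < e)"
proof -
  obtain D :: "'x set" where D: "countable D" "\<And>X. open X \<Longrightarrow> X \<noteq> {} \<Longrightarrow> \<exists>d\<in>D. d \<in> X"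
    by (rule countable_dense_setE) blast
  have "D \<noteq> {}" using D(2)[of UNIV] by auto
  have "\<exists>i. dist (from_nat_into D i) y < e" if "e > 0" for y e
  proof -
    obtain d where "d \<in> D" "d \<in> ball y e" using D(2)[of "ball y e"] \<open>e > 0\<close> by auto
    moreover obtain i where "from_nat_into D i = d"
      using from_nat_into_surj[OF D(1) \<open>d \<in> D\<close>] by blast
    ultimately show ?thesis by (auto simp: dist_commute)
  qed
  then show ?thesis by blast
qed

lemma measurable_first_choice:
  fixes q :: "nat \<Rightarrow> 'x::topological_space"
  assumes [measurable]: "\<And>i. Measurable.pred M (P i)"
    and "\<And>\<omega>. \<omega> \<in> space M \<Longrightarrow> \<exists>i. P i \<omega>"
  shows "\<exists>v\<in>borel_measurable M. \<forall>\<omega>\<in>space M. \<exists>i. v \<omega> = q i \<and> P i \<omega>"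
proof (intro bexI ballI)
  fix \<omega> assume "\<omega> \<in> space M"
  show "\<exists>i. q (LEAST i. P i \<omega>) = q i \<and> P i \<omega>"
    using LeastI_ex[OF assms(2)[OF \<open>\<omega> \<in> space M\<close>]] by blast
next
  show "(\<lambda>\<omega>. q (LEAST i. P i \<omega>)) \<in> borel_measurable M" by measurable
qed

text \<open>One step of the Kuratowski--Ryll-Nardzewski construction: take the first point of a fixed dense
  sequence that is \<open>e\<close>-close to \<open>F \<omega>\<close> without moving further than the current error \<open>c\<close>. Only
  countably many values occur, so measurability reduces to that of distances to fixed points.\<close>

lemma approximate_selection_refine:
  fixes F :: "'w \<Rightarrow> 'x::polish_space set"
  assumes F: "random_set M F" and u [measurable]: "u \<in> borel_measurable M"
    and near: "\<And>\<omega>. \<omega> \<in> space M \<Longrightarrow> infdist (u \<omega>) (F \<omega>) < c" and "e > 0"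
  shows "\<exists>v\<in>borel_measurable M. \<forall>\<omega>\<in>space M. infdist (v \<omega>) (F \<omega>) < e \<and> dist (u \<omega>) (v \<omega>) < c"
proof -
  obtain q :: "nat \<Rightarrow> 'x" where q: "\<And>y e. e > 0 \<Longrightarrow> \<exists>i. dist (q i) y < e"
    using dense_sequence_exists by blast
  have [measurable]: "(\<lambda>\<omega>. infdist x (F \<omega>)) \<in> borel_measurable M" for x
    using F by (simp add: random_set_def)
  define P where "P i \<omega> \<longleftrightarrow> infdist (q i) (F \<omega>) < e \<and> dist (u \<omega>) (q i) < c" for i \<omega>
  have "Measurable.pred M (P i)" for i unfolding P_def by measurable
  moreover have "\<exists>i. P i \<omega>" if \<omega>: "\<omega> \<in> space M" for \<omega>
  proof -
    have "F \<omega> \<noteq> {}" using F \<omega> by (simp add: random_set_def)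
    then obtain y where y: "y \<in> F \<omega>" "dist (u \<omega>) y < c"
      using near[OF \<omega>] by (auto simp: infdist_notempty cINF_less_iff)
    obtain i where i: "dist (q i) y < min e (c - dist (u \<omega>) y)"
      using q[of "min e (c - dist (u \<omega>) y)" y] y(2) \<open>e > 0\<close> by auto
    have "infdist (q i) (F \<omega>) \<le> dist (q i) y" by (rule infdist_le[OF y(1)])
    moreover have "dist (u \<omega>) (q i) \<le> dist (u \<omega>) y + dist (q i) y" by (rule dist_triangle2)
    ultimately have "P i \<omega>" using i unfolding P_def by auto
    then show ?thesis ..
  qed
  ultimately have "\<exists>v\<in>borel_measurable M. \<forall>\<omega>\<in>space M. \<exists>i. v \<omega> = q i \<and> P i \<omega>"
    by (rule measurable_first_choice)
  then show ?thesis unfolding P_def by metis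
qed

text \<open>Refining with errors \<open>c / 2 ^ n\<close> gives a uniformly Cauchy sequence whose limit lies in the
  closed set \<open>F \<omega>\<close>; the total displacement is at most the geometric sum \<open>2 * c\<close>.\<close>

lemma measurable_selection_near:
  fixes F :: "'w \<Rightarrow> 'x::polish_space set"
  assumes F: "random_set M F" and u: "u \<in> borel_measurable M"
    and near: "\<And>\<omega>. \<omega> \<in> space M \<Longrightarrow> infdist (u \<omega>) (F \<omega>) < c" and "c > 0"
  shows "\<exists>f\<in>borel_measurable M. \<forall>\<omega>\<in>space M. f \<omega> \<in> F \<omega> \<and> dist (u \<omega>) (f \<omega>) \<le> 2 * c"
proof -
  let ?P = "\<lambda>n v. v \<in> borel_measurable M \<and> (\<forall>\<omega>\<in>space M. infdist (v \<omega>) (F \<omega>) < c / 2 ^ n)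
    \<and> (n = 0 \<longrightarrow> v = u)"
  have "\<exists>v. \<forall>n. ?P n (v n) \<and> (\<forall>\<omega>\<in>space M. dist (v n \<omega>) (v (Suc n) \<omega>) < c / 2 ^ n)"
  proof (rule dependent_nat_choice)
    show "\<exists>v. ?P 0 v" using u near by auto
  next
    fix v n assume v: "?P n v"
    show "\<exists>w. ?P (Suc n) w \<and> (\<forall>\<omega>\<in>space M. dist (v \<omega>) (w \<omega>) < c / 2 ^ n)"
      using approximate_selection_refine[OF F, of v "c / 2 ^ n" "c / 2 ^ Suc n"] v \<open>c > 0\<close> by auto
  qed
  then obtain v where meas: "\<And>n. v n \<in> borel_measurable M" and v0: "v 0 = u"
    and vF: "\<And>n \<omega>. \<omega> \<in> space M \<Longrightarrow> infdist (v n \<omega>) (F \<omega>) < c / 2 ^ n"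
    and step: "\<And>n \<omega>. \<omega> \<in> space M \<Longrightarrow> dist (v n \<omega>) (v (Suc n) \<omega>) < c / 2 ^ n"
    by metis
  have tele: "dist (v m \<omega>) (v (m + k) \<omega>) \<le> 2 * c / 2 ^ m * (1 - 1 / 2 ^ k)"
    if \<omega>: "\<omega> \<in> space M" for \<omega> m k
  proof (induction k)
    case (Suc k)
    have "dist (v m \<omega>) (v (m + Suc k) \<omega>) \<le> dist (v m \<omega>) (v (m + k) \<omega>) + c / 2 ^ (m + k)"
      using dist_triangle[of "v m \<omega>" "v (m + Suc k) \<omega>" "v (m + k) \<omega>"] step[OF \<omega>, of "m + k"] by simp
    also have "\<dots> \<le> 2 * c / 2 ^ m * (1 - 1 / 2 ^ k) + c / 2 ^ (m + k)" using Suc by simp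
    also have "\<dots> = 2 * c / 2 ^ m * (1 - 1 / 2 ^ Suc k)" by (simp add: field_simps power_add)
    finally show ?case .
  qed simp
  have tail: "dist (v m \<omega>) (v n \<omega>) \<le> 2 * c / 2 ^ m" if "\<omega> \<in> space M" "m \<le> n" for \<omega> m n
  proof -
    have "2 * c / 2 ^ m * (1 - 1 / 2 ^ (n - m)) \<le> 2 * c / 2 ^ m * 1"
      using \<open>c > 0\<close> by (intro mult_left_mono) auto
    with tele[OF that(1), of m "n - m"] that(2) show ?thesis by simp
  qed
  have small: "(\<lambda>n. K / 2 ^ n) \<longlonglongrightarrow> 0" for K :: real
    using tendsto_mult_right_zero[OF LIMSEQ_realpow_zero[of "1/2::real"], of K]
    by (simp add: power_divide)
  have "convergent (\<lambda>n. v n \<omega>)" if \<omega>: "\<omega> \<in> space M" for \<omega>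
  proof (rule Cauchy_convergent, rule metric_CauchyI)
    fix e :: real assume "e > 0"
    then have "\<forall>\<^sub>F n in sequentially. 2 * c / 2 ^ n < e / 2"
      using order_tendstoD(2)[OF small[of "2 * c"], of "e / 2"] by simp
    then obtain N where N: "2 * c / 2 ^ N < e / 2"
      using eventually_happens' sequentially_bot by blast
    have "dist (v m \<omega>) (v n \<omega>) < e" if "m \<ge> N" "n \<ge> N" for m n
      using tail[OF \<omega> that(1)] tail[OF \<omega> that(2)] N
        dist_triangle3[of "v m \<omega>" "v n \<omega>" "v N \<omega>"] by linarith
    then show "\<exists>N. \<forall>m\<ge>N. \<forall>n\<ge>N. dist (v m \<omega>) (v n \<omega>) < e" by blast
  qed
  then have conv: "(\<lambda>n. v n \<omega>) \<longlonglongrightarrow> lim (\<lambda>n. v n \<omega>)" if "\<omega> \<in> space M" for \<omega>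
    using that convergent_LIMSEQ_iff by blast
  show ?thesis
  proof (intro bexI ballI conjI)
    show "(\<lambda>\<omega>. lim (\<lambda>n. v n \<omega>)) \<in> borel_measurable M"
      by (rule borel_measurable_LIMSEQ_metric[OF meas conv])
    fix \<omega> assume \<omega>: "\<omega> \<in> space M"
    have "(\<lambda>n. infdist (v n \<omega>) (F \<omega>)) \<longlonglongrightarrow> infdist (lim (\<lambda>n. v n \<omega>)) (F \<omega>)"
      by (rule tendsto_infdist[OF conv[OF \<omega>]])
    moreover have "(\<lambda>n. infdist (v n \<omega>) (F \<omega>)) \<longlonglongrightarrow> 0"
      by (rule tendsto_sandwich[OF _ _ tendsto_const small[of c]])
         (use vF[OF \<omega>] in \<open>auto intro!: always_eventually less_imp_le simp: infdist_nonneg\<close>)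
    ultimately have "infdist (lim (\<lambda>n. v n \<omega>)) (F \<omega>) = 0" by (rule LIMSEQ_unique)
    then show "lim (\<lambda>n. v n \<omega>) \<in> F \<omega>"
      using F \<omega> by (simp add: random_set_def in_closed_iff_infdist_zero)
    show "dist (u \<omega>) (lim (\<lambda>n. v n \<omega>)) \<le> 2 * c"
      by (rule LIMSEQ_le_const2[OF tendsto_dist[OF tendsto_const conv[OF \<omega>]]])
         (use tail[OF \<omega>, of 0] v0 in auto)
  qed
qed

text \<open>The selection with index \<open>(i, j)\<close> starts from the point \<open>q i\<close> of a dense sequence wherever that
  point is \<open>1 / 2 ^ j\<close>-close to the set, so it ends within \<open>2 / 2 ^ j\<close> of \<open>q i\<close> there. Every point
  of the set is close to some such \<open>q i\<close>, hence to the selection.\<close>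

theorem castaing_representation:
  fixes F :: "'w \<Rightarrow> 'x::polish_space set"
  assumes F: "random_set M F"
  shows "\<exists>f :: nat \<Rightarrow> 'w \<Rightarrow> 'x. (\<forall>k. f k \<in> borel_measurable M) \<and>
    (\<forall>\<omega>\<in>space M. (\<forall>k. f k \<omega> \<in> F \<omega>) \<and> F \<omega> \<subseteq> closure (range (\<lambda>k. f k \<omega>)))"
proof -
  obtain q :: "nat \<Rightarrow> 'x" where q: "\<And>y e. e > 0 \<Longrightarrow> \<exists>i. dist (q i) y < e"
    using dense_sequence_exists by blast
  have [measurable]: "(\<lambda>\<omega>. infdist x (F \<omega>)) \<in> borel_measurable M" for x
    using F by (simp add: random_set_def)
  have "\<exists>f\<in>borel_measurable M. \<forall>\<omega>\<in>space M. f \<omega> \<in> F \<omega> \<and>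
      (infdist (q i) (F \<omega>) < 1 / 2 ^ j \<longrightarrow> dist (q i) (f \<omega>) \<le> 2 / 2 ^ j)" for i j :: nat
  proof -
    have "\<exists>w\<in>borel_measurable M. \<forall>\<omega>\<in>space M. \<exists>i. w \<omega> = q i \<and> infdist (q i) (F \<omega>) < 1 / 2 ^ j"
    proof (rule measurable_first_choice)
      fix \<omega> assume "\<omega> \<in> space M"
      then obtain y where y: "y \<in> F \<omega>" using F by (auto simp: random_set_def)
      obtain i where "dist (q i) y < 1 / 2 ^ j" using q[of "1 / 2 ^ j" y] by auto
      then show "\<exists>i. infdist (q i) (F \<omega>) < 1 / 2 ^ j"
        using infdist_le[OF y, of "q i"] by (auto intro!: exI[of _ i])
    qed measurable
    then obtain w where [measurable]: "w \<in> borel_measurable M"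
      and w: "\<And>\<omega>. \<omega> \<in> space M \<Longrightarrow> infdist (w \<omega>) (F \<omega>) < 1 / 2 ^ j" by metis
    \<comment> \<open>Where \<open>q i\<close> is too far from the set, any \<open>1 / 2 ^ j\<close>-close starting point will do.\<close>
    define u where "u \<omega> = (if infdist (q i) (F \<omega>) < 1 / 2 ^ j then q i else w \<omega>)" for \<omega>
    have "u \<in> borel_measurable M" unfolding u_def by measurable
    moreover have "infdist (u \<omega>) (F \<omega>) < 1 / 2 ^ j" if "\<omega> \<in> space M" for \<omega>
      using w[OF that] by (simp add: u_def)
    ultimately obtain f where f: "f \<in> borel_measurable M"
      "\<And>\<omega>. \<omega> \<in> space M \<Longrightarrow> f \<omega> \<in> F \<omega> \<and> dist (u \<omega>) (f \<omega>) \<le> 2 * (1 / 2 ^ j)"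
      using measurable_selection_near[OF F, of u "1 / 2 ^ j"] by (metis zero_less_divide_1_iff zero_less_numeral zero_less_power)
    have "dist (q i) (f \<omega>) \<le> 2 / 2 ^ j" if "\<omega> \<in> space M" "infdist (q i) (F \<omega>) < 1 / 2 ^ j" for \<omega>
      using f(2)[OF that(1)] that(2) by (simp add: u_def)
    with f show ?thesis by blast
  qed
  then obtain f where f: "\<And>i j. f i j \<in> borel_measurable M"
    "\<And>i j \<omega>. \<omega> \<in> space M \<Longrightarrow> f i j \<omega> \<in> F \<omega> \<and>
      (infdist (q i) (F \<omega>) < 1 / 2 ^ j \<longrightarrow> dist (q i) (f i j \<omega>) \<le> 2 / 2 ^ j)"
    by metis
  define g where "g k = f (fst (prod_decode k)) (snd (prod_decode k))" for k
  have "F \<omega> \<subseteq> closure (range (\<lambda>k. g k \<omega>))" if \<omega>: "\<omega> \<in> space M" for \<omega>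
  proof
    fix y assume y: "y \<in> F \<omega>"
    have "\<exists>z\<in>range (\<lambda>k. g k \<omega>). dist z y < e" if "e > 0" for e
    proof -
      obtain j where j: "(1 / 2) ^ j < e / 3"
        using real_arch_pow_inv[of "e / 3" "1 / 2"] \<open>e > 0\<close> by auto
      then have j: "3 / 2 ^ j < e" by (simp add: power_divide field_simps)
      obtain i where i: "dist (q i) y < 1 / 2 ^ j" using q[of "1 / 2 ^ j" y] by auto
      have "infdist (q i) (F \<omega>) < 1 / 2 ^ j" using infdist_le[OF y, of "q i"] i by linarith
      then have "dist (q i) (f i j \<omega>) \<le> 2 / 2 ^ j" using f(2)[OF \<omega>] by blast
      then have "dist (f i j \<omega>) y < 2 / 2 ^ j + 1 / 2 ^ j"
        using i dist_triangle3[of "f i j \<omega>" y "q i"] by linarith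
      also have "\<dots> < e" using j by (simp add: add_divide_distrib[symmetric])
      finally have "dist (g (prod_encode (i, j)) \<omega>) y < e" by (simp add: g_def)
      then show ?thesis by blast
    qed
    then show "y \<in> closure (range (\<lambda>k. g k \<omega>))" unfolding closure_approachable by blast
  qed
  with f show ?thesis by (intro exI[of _ g]) (auto simp: g_def)
qed

section \<open>Pullback omega-limit sets\<close>

definition pullback ::
  "(real \<Rightarrow> 'w \<Rightarrow> 'w) \<Rightarrow> (real \<Rightarrow> 'w \<Rightarrow> 'x \<Rightarrow> 'x) \<Rightarrow> ('w \<Rightarrow> 'x set) \<Rightarrow> 'w \<Rightarrow> real \<Rightarrow> 'x set"
where
  "pullback \<theta> \<phi> B \<omega> t = \<phi> t (\<theta> (- t) \<omega>) ` B (\<theta> (- t) \<omega>)"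

lemma attracts_iff_pullback:
  "attracts M \<theta> \<phi> A B \<longleftrightarrow>
    (\<forall>\<omega>\<in>space M. ((\<lambda>t. semidist (pullback \<theta> \<phi> B \<omega> t) (A \<omega>)) \<longlongrightarrow> 0) at_top)"
  by (simp add: attracts_def pullback_def)

lemma asymptotically_compact_iff_pullback:
  "asymptotically_compact M \<theta> \<phi> \<D> \<longleftrightarrow>
    (\<forall>\<omega>\<in>space M. \<forall>D\<in>\<D>. asymptotically_precompact (pullback \<theta> \<phi> D \<omega>))"
proof
  assume ac: "asymptotically_compact M \<theta> \<phi> \<D>"
  show "\<forall>\<omega>\<in>space M. \<forall>D\<in>\<D>. asymptotically_precompact (pullback \<theta> \<phi> D \<omega>)"
    unfolding asymptotically_precompact_def
  proof (intro ballI allI impI)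
    fix \<omega> D and t :: "nat \<Rightarrow> real" and z
    assume *: "\<omega> \<in> space M" "D \<in> \<D>" "\<forall>n. 0 \<le> t n" "filterlim t at_top sequentially"
      "\<forall>n. z n \<in> pullback \<theta> \<phi> D \<omega> (t n)"
    then have "\<exists>x. x \<in> D (\<theta> (- t n) \<omega>) \<and> z n = \<phi> (t n) (\<theta> (- t n) \<omega>) x" for n
      unfolding pullback_def by (meson imageE)
    then obtain x where x: "\<And>n. x n \<in> D (\<theta> (- t n) \<omega>)"
      "\<And>n. z n = \<phi> (t n) (\<theta> (- t n) \<omega>) (x n)" by metis
    have "z = (\<lambda>n. \<phi> (t n) (\<theta> (- t n) \<omega>) (x n))" using x(2) by auto
    then show "\<exists>r. strict_mono r \<and> convergent (z \<circ> r)"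
      using ac[unfolded asymptotically_compact_def, rule_format, OF *(1,2), of t x] *(3,4) x(1) by blast
  qed
next
  assume pc: "\<forall>\<omega>\<in>space M. \<forall>D\<in>\<D>. asymptotically_precompact (pullback \<theta> \<phi> D \<omega>)"
  show "asymptotically_compact M \<theta> \<phi> \<D>"
    unfolding asymptotically_compact_def
  proof (intro ballI allI impI)
    fix \<omega> D and t :: "nat \<Rightarrow> real" and x
    assume *: "\<omega> \<in> space M" "D \<in> \<D>" "\<forall>n. 0 \<le> t n" "filterlim t at_top sequentially"
      "\<forall>n. x n \<in> D (\<theta> (- t n) \<omega>)"
    let ?z = "\<lambda>n. \<phi> (t n) (\<theta> (- t n) \<omega>) (x n)"
    have "?z n \<in> pullback \<theta> \<phi> D \<omega> (t n)" for n
      using *(5) by (auto simp: pullback_def)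
    then show "\<exists>r. strict_mono r \<and> convergent (?z \<circ> r)"
      using pc[rule_format, OF *(1,2), unfolded asymptotically_precompact_def, rule_format, of t ?z] *(3,4)
      by blast
  qed
qed

context metric_dynamical_system
begin

lemma flow_component_measurable [measurable]: "\<theta> t \<in> M \<rightarrow>\<^sub>M M"
proof -
  have "(\<lambda>\<omega>. (\<lambda>(t, \<omega>). \<theta> t \<omega>) (t, \<omega>)) \<in> M \<rightarrow>\<^sub>M M"
    by (rule measurable_compose[OF _ flow_measurable]) simp
  then show ?thesis by simp
qed

lemma flow_in_space: "\<omega> \<in> space M \<Longrightarrow> \<theta> t \<omega> \<in> space M"
  by (rule measurable_space[OF flow_component_measurable])

end

context random_dynamical_system
begin

text \<open>The cocycle property in pullback form: running the images at \<open>\<omega>\<close> for a further time \<open>s\<close> gives the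
  images at \<open>\<theta> s \<omega>\<close> with \<open>s\<close> more units of pullback time.\<close>

lemma image_pullback:
  assumes "\<omega> \<in> space M" and "0 \<le> s" and "0 \<le> t"
  shows "\<phi> s \<omega> ` pullback \<theta> \<phi> B \<omega> t = pullback \<theta> \<phi> B (\<theta> s \<omega>) (s + t)"
proof -
  have 1: "\<theta> (- (s + t)) (\<theta> s \<omega>) = \<theta> (- t) \<omega>"
    using flow_add[OF assms(1), of "- (s + t)" s] by simp
  have 2: "\<theta> t (\<theta> (- t) \<omega>) = \<omega>"
    using flow_add[OF assms(1), of t "- t"] flow_zero[OF assms(1)] by simp
  have "\<phi> (s + t) (\<theta> (- t) \<omega>) x = \<phi> s \<omega> (\<phi> t (\<theta> (- t) \<omega>) x)" for x
    using cocycle_add[OF assms(3,2) flow_in_space[OF assms(1), of "- t"], of x] 2 by simp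
  then show ?thesis unfolding pullback_def 1 by (auto simp: image_image)
qed

lemma pullback_selection_measurable:
  assumes [measurable]: "f \<in> borel_measurable M" and "0 \<le> t"
  shows "(\<lambda>\<omega>. \<phi> t (\<theta> (- t) \<omega>) (f (\<theta> (- t) \<omega>))) \<in> borel_measurable M"
proof -
  have "(\<lambda>\<omega>. t) \<in> M \<rightarrow>\<^sub>M restrict_space borel {0..}"
    using assms(2) by (intro measurable_restrict_space2) auto
  moreover have "(\<lambda>\<omega>. (f (\<theta> (- t) \<omega>), \<theta> (- t) \<omega>)) \<in> M \<rightarrow>\<^sub>M borel \<Otimes>\<^sub>M M" by measurable
  ultimately have "(\<lambda>\<omega>. (t, f (\<theta> (- t) \<omega>), \<theta> (- t) \<omega>)) \<in>
      M \<rightarrow>\<^sub>M restrict_space borel {0..} \<Otimes>\<^sub>M borel \<Otimes>\<^sub>M M"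
    by (rule measurable_Pair)
  from measurable_compose[OF this cocycle_measurable] show ?thesis by simp
qed

end

locale quasi_continuous_rds = random_dynamical_system M \<theta> \<phi>
  for M :: "'w measure" and \<theta> :: "real \<Rightarrow> 'w \<Rightarrow> 'w"
    and \<phi> :: "real \<Rightarrow> 'w \<Rightarrow> 'x::{banach, polish_space} \<Rightarrow> 'x" +
  fixes \<tau> :: "'x topology"
  assumes topspace_UNIV: "topspace \<tau> = UNIV"
    and hausdorff: "Hausdorff_space \<tau>"
    and weaker: "\<And>U. openin \<tau> U \<Longrightarrow> open U"
    and quasi_cont: "quasi_continuous M \<tau> \<phi>"
begin

lemma limitin_of_tendsto:
  assumes "f \<longlonglongrightarrow> l"
  shows "limitin \<tau> f l sequentially"
  unfolding limitin_def
proof (intro conjI allI impI)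
  show "l \<in> topspace \<tau>" by (simp add: topspace_UNIV)
  fix U assume "openin \<tau> U \<and> l \<in> U"
  then show "\<forall>\<^sub>F n in sequentially. f n \<in> U"
    using topological_tendstoD[OF assms] weaker by blast
qed

lemma compactin_of_compact:
  assumes "compact K"
  shows "compactin \<tau> K"
  unfolding compactin_def
proof (intro conjI allI impI)
  show "K \<subseteq> topspace \<tau>" by (simp add: topspace_UNIV)
  fix \<U> assume *: "Ball \<U> (openin \<tau>) \<and> K \<subseteq> \<Union>\<U>"
  then have "\<And>U. U \<in> \<U> \<Longrightarrow> open U" using weaker by blast
  with * obtain \<F> where "\<F> \<subseteq> \<U>" "finite \<F>" "K \<subseteq> \<Union>\<F>"
    using compactE[OF assms, of \<U>] by metis
  then show "\<exists>\<F>. finite \<F> \<and> \<F> \<subseteq> \<U> \<and> K \<subseteq> \<Union>\<F>" by blast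
qed

lemma cocycle_limitin:
  assumes "\<omega> \<in> space M" and "0 \<le> s" and "y \<longlonglongrightarrow> x" and "bounded (range (\<lambda>n. \<phi> s \<omega> (y n)))"
  shows "limitin \<tau> (\<lambda>n. \<phi> s \<omega> (y n)) (\<phi> s \<omega> x) sequentially"
  using quasi_cont[unfolded quasi_continuous_def, rule_format, of \<omega> "\<lambda>_. s" y s x] assms by simp

text \<open>The substitute for norm continuity of the cocycle: \<open>z\<close> and \<open>\<phi> s \<omega> x\<close> are both limits of the
  images in the Hausdorff topology \<open>\<tau>\<close>.\<close>

lemma cocycle_closed_graph:
  assumes "\<omega> \<in> space M" and "0 \<le> s" and "y \<longlonglongrightarrow> x" and lim: "(\<lambda>n. \<phi> s \<omega> (y n)) \<longlonglongrightarrow> z"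
  shows "z = \<phi> s \<omega> x"
proof -
  have "bounded (range (\<lambda>n. \<phi> s \<omega> (y n)))" by (rule convergent_imp_bounded[OF lim])
  then have "limitin \<tau> (\<lambda>n. \<phi> s \<omega> (y n)) (\<phi> s \<omega> x) sequentially"
    using cocycle_limitin assms by blast
  then show ?thesis
    by (rule limitin_Hausdorff_unique[OF limitin_of_tendsto[OF lim] _ trivial_limit_sequentially hausdorff])
qed

text \<open>Both inclusions track a sequence approaching a limit point, forwards by time \<open>s\<close> or backwards by
  time \<open>s\<close>. Precompactness makes a subsequence of the tracked points converge, and the closed graph
  identifies the limit.\<close>

lemma limit_set_invariant:
  assumes \<omega>: "\<omega> \<in> space M" and s: "0 \<le> s"
    and pc: "\<And>\<omega>. \<omega> \<in> space M \<Longrightarrow> asymptotically_precompact (pullback \<theta> \<phi> B \<omega>)"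
  shows "\<phi> s \<omega> ` limit_set (pullback \<theta> \<phi> B \<omega>) = limit_set (pullback \<theta> \<phi> B (\<theta> s \<omega>))"
proof (intro equalityI subsetI)
  fix x assume "x \<in> \<phi> s \<omega> ` limit_set (pullback \<theta> \<phi> B \<omega>)"
  then obtain y where x: "x = \<phi> s \<omega> y" and y: "y \<in> limit_set (pullback \<theta> \<phi> B \<omega>)" by blast
  obtain t z where t: "\<And>n. real n \<le> t n" and z: "\<And>n. z n \<in> pullback \<theta> \<phi> B \<omega> (t n)" "z \<longlonglongrightarrow> y"
    by (rule limit_setE[OF y]) blast
  have t0: "0 \<le> t n" for n using t[of n] by linarith
  have "\<phi> s \<omega> (z n) \<in> pullback \<theta> \<phi> B (\<theta> s \<omega>) (s + t n)" for n
    using image_pullback[OF \<omega> s t0[of n], of B] z(1)[of n] by blast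
  moreover have "real n \<le> s + t n" for n using t[of n] s by linarith
  ultimately obtain r l where r: "strict_mono r" "(\<lambda>n. \<phi> s \<omega> (z (r n))) \<longlonglongrightarrow> l"
    "l \<in> limit_set (pullback \<theta> \<phi> B (\<theta> s \<omega>))"
    using asymptotically_precompactE[OF pc[OF flow_in_space[OF \<omega>, of s]],
        of "\<lambda>n. s + t n" "\<lambda>n. \<phi> s \<omega> (z n)"] by metis
  have "(\<lambda>n. z (r n)) \<longlonglongrightarrow> y" using LIMSEQ_subseq_LIMSEQ[OF z(2) r(1)] by (simp add: o_def)
  then have "l = x" unfolding x by (rule cocycle_closed_graph[OF \<omega> s _ r(2)])
  with r(3) show "x \<in> limit_set (pullback \<theta> \<phi> B (\<theta> s \<omega>))" by simp
next
  fix y assume y: "y \<in> limit_set (pullback \<theta> \<phi> B (\<theta> s \<omega>))"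
  obtain t z where t: "\<And>n. real n \<le> t n"
    and z: "\<And>n. z n \<in> pullback \<theta> \<phi> B (\<theta> s \<omega>) (t n)" "z \<longlonglongrightarrow> y"
    by (rule limit_setE[OF y]) blast
  obtain N :: nat where N: "s \<le> real N" using real_arch_simple by blast
  \<comment> \<open>Dropping the first \<open>N\<close> terms keeps all pullback times nonnegative after subtracting \<open>s\<close>.\<close>
  have t': "real n \<le> t (n + N) - s" for n using t[of "n + N"] N by simp
  have "\<exists>w. w \<in> pullback \<theta> \<phi> B \<omega> (t (n + N) - s) \<and> z (n + N) = \<phi> s \<omega> w" for n
  proof -
    have "0 \<le> t (n + N) - s" using t'[of n] by linarith
    from image_pullback[OF \<omega> s this, of B] z(1)[of "n + N"] show ?thesis by auto
  qed
  then obtain w where w: "\<And>n. w n \<in> pullback \<theta> \<phi> B \<omega> (t (n + N) - s)"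
    "\<And>n. z (n + N) = \<phi> s \<omega> (w n)" by metis
  obtain r x where r: "strict_mono r" "(\<lambda>n. w (r n)) \<longlonglongrightarrow> x"
    "x \<in> limit_set (pullback \<theta> \<phi> B \<omega>)"
    using asymptotically_precompactE[OF pc[OF \<omega>], of "\<lambda>n. t (n + N) - s" w, OF t' w(1)] by metis
  have "(\<lambda>n. z (r n + N)) \<longlonglongrightarrow> y"
    using LIMSEQ_subseq_LIMSEQ[OF LIMSEQ_ignore_initial_segment[OF z(2), of N] r(1)]
    by (simp add: o_def)
  then have "y = \<phi> s \<omega> x"
    unfolding w(2) by (rule cocycle_closed_graph[OF \<omega> s r(2)])
  with r(3) show "y \<in> \<phi> s \<omega> ` limit_set (pullback \<theta> \<phi> B \<omega>)" by blast
qed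

section \<open>Measurability of the limit set\<close>

lemma separation_from_compact:
  assumes "compact K" and "a \<notin> K"
  obtains U V where "openin \<tau> U" and "openin \<tau> V" and "a \<in> U" and "K \<subseteq> V" and "U \<inter> V = {}"
proof -
  have "compactin \<tau> {a}" by (rule compactin_of_compact) simp
  moreover have "compactin \<tau> K" by (rule compactin_of_compact[OF assms(1)])
  moreover have "disjnt {a} K" using assms(2) by simp
  ultimately obtain U V where "openin \<tau> U" "openin \<tau> V" "{a} \<subseteq> U" "K \<subseteq> V" "disjnt U V"
    by (rule Hausdorff_space_compact_separation[OF hausdorff])
  then show thesis by (intro that[of U V]) (simp_all add: disjnt_def)
qed

text \<open>Suppose all points reached from the selections after late integer times stay at distance \<open>e\<close>
  from \<open>a\<close>. By invariance \<open>a = \<phi> m (\<theta> (-m) \<omega>) b\<close> with \<open>b\<close> in \<open>F (\<theta> (-m) \<omega>)\<close>. For large \<open>m\<close> the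
  images of \<open>F\<close> are bounded, being attracted by the compact limit set \<open>A\<close>, so quasi-continuity
  applies to selections converging to \<open>b\<close>: every \<open>\<tau>\<close>-neighbourhood \<open>U\<close> of \<open>a\<close> contains a point
  reached from a selection. Choose \<open>U\<close> disjoint from a \<open>\<tau>\<close>-neighbourhood \<open>V\<close> of the compact set
  \<open>A - ball a e\<close>. As \<open>m\<close> grows the points in \<open>U\<close> accumulate in norm at a point of \<open>A - ball a e\<close>,
  and since \<open>V\<close> is norm open some of them lie in \<open>V\<close>, a contradiction.\<close>

lemma limit_set_approx_by_selections:
  assumes \<omega>: "\<omega> \<in> space M"
    and pc: "\<And>\<omega>. \<omega> \<in> space M \<Longrightarrow> asymptotically_precompact (pullback \<theta> \<phi> F \<omega>)"
    and F: "\<And>\<omega>. \<omega> \<in> space M \<Longrightarrow> F \<omega> \<noteq> {}"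
    and sub: "\<And>\<omega>. \<omega> \<in> space M \<Longrightarrow> limit_set (pullback \<theta> \<phi> F \<omega>) \<subseteq> F \<omega>"
    and f: "\<And>k \<omega>. \<omega> \<in> space M \<Longrightarrow> f k \<omega> \<in> F \<omega>"
    and dense: "\<And>\<omega>. \<omega> \<in> space M \<Longrightarrow> F \<omega> \<subseteq> closure (range (\<lambda>k::nat. f k \<omega>))"
    and a: "a \<in> limit_set (pullback \<theta> \<phi> F \<omega>)" and "e > 0"
  shows "\<exists>m\<ge>N. \<exists>k. dist (\<phi> (real m) (\<theta> (- real m) \<omega>) (f k (\<theta> (- real m) \<omega>))) a < e"
proof (rule ccontr)
  assume far: "\<not> ?thesis"
  define A where "A = limit_set (pullback \<theta> \<phi> F \<omega>)"
  have spc: "\<theta> t \<omega> \<in> space M" for t by (rule flow_in_space[OF \<omega>])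
  have ne: "pullback \<theta> \<phi> F \<omega> t \<noteq> {}" for t using F[OF spc] by (simp add: pullback_def)
  have A: "compact A" "A \<noteq> {}"
    unfolding A_def by (rule compact_limit_set[OF pc[OF \<omega>]], rule limit_set_nonempty[OF pc[OF \<omega>] ne])
  have "\<forall>\<^sub>F t in at_top. bounded (pullback \<theta> \<phi> F \<omega> t)"
    using eventually_bounded_of_attracting[OF semidist_tendsto_0I[OF pc[OF \<omega>] subset_refl ne]]
      A compact_imp_bounded unfolding A_def by blast
  then obtain T where T: "\<And>t. T \<le> t \<Longrightarrow> bounded (pullback \<theta> \<phi> F \<omega> t)"
    by (auto simp: eventually_at_top_linorder)
  obtain N' :: nat where N': "T \<le> real N'" using real_arch_simple by blast
  have "compact (A - ball a e)" by (rule compact_diff[OF A(1) open_ball])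
  moreover have "a \<notin> A - ball a e" using \<open>e > 0\<close> by simp
  ultimately obtain U V where UV: "openin \<tau> U" "openin \<tau> V" "a \<in> U" "A - ball a e \<subseteq> V" "U \<inter> V = {}"
    by (rule separation_from_compact)
  define m where "m n = n + N + N'" for n
  have "\<exists>k. \<phi> (real (m n)) (\<theta> (- real (m n)) \<omega>) (f k (\<theta> (- real (m n)) \<omega>)) \<in> U" for n
  proof -
    let ?\<omega> = "\<theta> (- real (m n)) \<omega>"
    have "\<theta> (real (m n)) ?\<omega> = \<omega>"
      using flow_add[OF \<omega>, of "real (m n)" "- real (m n)"] flow_zero[OF \<omega>] by simp
    then have "\<phi> (real (m n)) ?\<omega> ` limit_set (pullback \<theta> \<phi> F ?\<omega>) = A"
      unfolding A_def using limit_set_invariant[OF spc[of "- real (m n)"] _ pc, of "real (m n)"] by simp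
    then obtain b where b: "b \<in> F ?\<omega>" "a = \<phi> (real (m n)) ?\<omega> b"
      using a sub[OF spc[of "- real (m n)"]] unfolding A_def by blast
    then obtain y where y: "\<And>i. y i \<in> range (\<lambda>k. f k ?\<omega>)" "y \<longlonglongrightarrow> b"
      using dense[OF spc[of "- real (m n)"]] closure_sequential by blast
    have "y i \<in> F ?\<omega>" for i using y(1)[of i] f[OF spc] by auto
    then have "range (\<lambda>i. \<phi> (real (m n)) ?\<omega> (y i)) \<subseteq> pullback \<theta> \<phi> F \<omega> (real (m n))"
      by (auto simp: pullback_def)
    moreover have "bounded (pullback \<theta> \<phi> F \<omega> (real (m n)))"
      by (rule T) (use N' in \<open>simp add: m_def\<close>)
    ultimately have "limitin \<tau> (\<lambda>i. \<phi> (real (m n)) ?\<omega> (y i)) a sequentially"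
      unfolding b(2) by (intro cocycle_limitin[OF spc _ y(2)]) (auto intro: bounded_subset)
    then have "\<forall>\<^sub>F i in sequentially. \<phi> (real (m n)) ?\<omega> (y i) \<in> U"
      using UV(1,3) unfolding limitin_def by blast
    then obtain i where "\<phi> (real (m n)) ?\<omega> (y i) \<in> U"
      using eventually_happens' sequentially_bot by blast
    then show ?thesis using y(1)[of i] by auto
  qed
  then obtain k where k: "\<And>n. \<phi> (real (m n)) (\<theta> (- real (m n)) \<omega>) (f (k n) (\<theta> (- real (m n)) \<omega>)) \<in> U"
    by metis
  define z where "z n = \<phi> (real (m n)) (\<theta> (- real (m n)) \<omega>) (f (k n) (\<theta> (- real (m n)) \<omega>))" for n
  have "z n \<in> pullback \<theta> \<phi> F \<omega> (real (m n))" for n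
    using f[OF spc] by (simp add: z_def pullback_def)
  moreover have "real n \<le> real (m n)" for n by (simp add: m_def)
  ultimately obtain r l where r: "(\<lambda>n. z (r n)) \<longlonglongrightarrow> l" "l \<in> A"
    using asymptotically_precompactE[OF pc[OF \<omega>], of "\<lambda>n. real (m n)" z] unfolding A_def by metis
  have "e \<le> dist (z (r n)) a" for n
  proof -
    have "N \<le> m (r n)" by (simp add: m_def)
    with far show ?thesis unfolding z_def by (meson not_less)
  qed
  then have "e \<le> dist l a"
    by (intro LIMSEQ_le_const[OF tendsto_dist[OF r(1) tendsto_const]]) auto
  then have "l \<in> V" using r(2) UV(4) by (auto simp: dist_commute)
  then have "\<forall>\<^sub>F n in sequentially. z (r n) \<in> V"
    using topological_tendstoD[OF r(1)] weaker[OF UV(2)] by blast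
  then obtain n where "z (r n) \<in> V"
    using eventually_happens' sequentially_bot by blast
  with k[of "r n"] UV(5) show False unfolding z_def by blast
qed

text \<open>The distance from \<open>x\<close> to the limit set equals the lower limit over \<open>m\<close> of the infimum over \<open>k\<close>
  of the distances from \<open>x\<close> to the points \<open>g m k \<omega>\<close> reached from the selections after time \<open>m\<close>. It is
  at most this lower limit because the limit set attracts these points, and at least this lower
  limit because they accumulate at a nearest point of the limit set.\<close>

theorem random_set_limit_set:
  assumes F: "random_set M F"
    and pc: "\<And>\<omega>. \<omega> \<in> space M \<Longrightarrow> asymptotically_precompact (pullback \<theta> \<phi> F \<omega>)"
    and sub: "\<And>\<omega>. \<omega> \<in> space M \<Longrightarrow> limit_set (pullback \<theta> \<phi> F \<omega>) \<subseteq> F \<omega>"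
  shows "random_set M (\<lambda>\<omega>. limit_set (pullback \<theta> \<phi> F \<omega>))"
proof -
  define A where "A \<omega> = limit_set (pullback \<theta> \<phi> F \<omega>)" for \<omega>
  have FD: "F \<omega> \<noteq> {}" if "\<omega> \<in> space M" for \<omega> using F that by (simp add: random_set_def)
  have ne: "pullback \<theta> \<phi> F \<omega> t \<noteq> {}" if "\<omega> \<in> space M" for \<omega> t
    using FD[OF flow_in_space[OF that]] by (simp add: pullback_def)
  have A: "compact (A \<omega>)" "A \<omega> \<noteq> {}" if "\<omega> \<in> space M" for \<omega>
    unfolding A_def
    by (rule compact_limit_set[OF pc[OF that]], rule limit_set_nonempty[OF pc[OF that] ne[OF that]])
  obtain f where fm: "\<And>k::nat. f k \<in> borel_measurable M"
    and fF: "\<And>k \<omega>. \<omega> \<in> space M \<Longrightarrow> f k \<omega> \<in> F \<omega>"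
    and fd: "\<And>\<omega>. \<omega> \<in> space M \<Longrightarrow> F \<omega> \<subseteq> closure (range (\<lambda>k. f k \<omega>))"
    using castaing_representation[OF F] by metis
  define g where "g m k \<omega> = \<phi> (real m) (\<theta> (- real m) \<omega>) (f k (\<theta> (- real m) \<omega>))" for m k :: nat and \<omega>
  have gm [measurable]: "g m k \<in> borel_measurable M" for m k
    unfolding g_def by (rule pullback_selection_measurable[OF fm]) simp
  have key: "ereal (infdist x (A \<omega>)) = liminf (\<lambda>m. INF k. ereal (dist x (g m k \<omega>)))"
    if \<omega>: "\<omega> \<in> space M" for x \<omega>
  proof (rule antisym)
    have gp: "g m k \<omega> \<in> pullback \<theta> \<phi> F \<omega> (real m)" for m k
      using fF[OF flow_in_space[OF \<omega>]] by (simp add: g_def pullback_def)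
    show "ereal (infdist x (A \<omega>)) \<le> liminf (\<lambda>m. INF k. ereal (dist x (g m k \<omega>)))"
    proof (rule ereal_le_epsilon2)
      fix e :: real assume "0 < e"
      have "\<forall>\<^sub>F t in at_top. \<forall>z\<in>pullback \<theta> \<phi> F \<omega> t. infdist z (A \<omega>) < e"
        unfolding A_def
        by (rule semidist_tendsto_0D[OF semidist_tendsto_0I[OF pc[OF \<omega>] subset_refl ne[OF \<omega>]] \<open>0 < e\<close>])
      then have "\<forall>\<^sub>F m in sequentially. \<forall>z\<in>pullback \<theta> \<phi> F \<omega> (real m). infdist z (A \<omega>) < e"
        using filterlim_real_sequentially by (rule eventually_compose_filterlim)
      then have "\<forall>\<^sub>F m in sequentially. ereal (infdist x (A \<omega>) - e) \<le> (INF k. ereal (dist x (g m k \<omega>)))"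
      proof (rule eventually_mono)
        fix m assume near: "\<forall>z\<in>pullback \<theta> \<phi> F \<omega> (real m). infdist z (A \<omega>) < e"
        have "infdist x (A \<omega>) - e \<le> dist x (g m k \<omega>)" for k
          using infdist_triangle[of x "A \<omega>" "g m k \<omega>"] near[rule_format, OF gp[of m k]] by linarith
        then show "ereal (infdist x (A \<omega>) - e) \<le> (INF k. ereal (dist x (g m k \<omega>)))"
          by (intro INF_greatest) simp
      qed
      then have "ereal (infdist x (A \<omega>) - e) \<le> liminf (\<lambda>m. INF k. ereal (dist x (g m k \<omega>)))"
        by (rule Liminf_bounded)
      then have "ereal (infdist x (A \<omega>) - e) + ereal e
          \<le> liminf (\<lambda>m. INF k. ereal (dist x (g m k \<omega>))) + ereal e"
        by (rule add_right_mono)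
      then show "ereal (infdist x (A \<omega>)) \<le> liminf (\<lambda>m. INF k. ereal (dist x (g m k \<omega>))) + ereal e"
        by simp
    qed
    obtain a where a: "a \<in> A \<omega>" "infdist x (A \<omega>) = dist x a"
      using compact_nearest_point[OF A[OF \<omega>]] by blast
    show "liminf (\<lambda>m. INF k. ereal (dist x (g m k \<omega>))) \<le> ereal (infdist x (A \<omega>))"
    proof (rule ereal_le_epsilon2)
      fix e :: real assume "0 < e"
      show "liminf (\<lambda>m. INF k. ereal (dist x (g m k \<omega>))) \<le> ereal (infdist x (A \<omega>)) + ereal e"
        unfolding liminf_SUP_INF
      proof (rule SUP_least)
        fix N
        obtain m k where mk: "m \<ge> N" "dist (g m k \<omega>) a < e"
          using limit_set_approx_by_selections[OF \<omega> pc FD sub fF fd a(1)[unfolded A_def] \<open>0 < e\<close>, of N]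
          unfolding g_def by blast
        have "dist x (g m k \<omega>) \<le> dist x a + e"
          using dist_triangle2[of x "g m k \<omega>" a] mk(2) by linarith
        then have "(INF k. ereal (dist x (g m k \<omega>))) \<le> ereal (infdist x (A \<omega>)) + ereal e"
          by (intro INF_lower2[of k]) (simp_all add: a(2))
        then show "(INF m\<in>{N..}. INF k. ereal (dist x (g m k \<omega>))) \<le> ereal (infdist x (A \<omega>)) + ereal e"
          by (rule INF_lower2[of m, rotated]) (use mk(1) in simp)
      qed
    qed
  qed
  have "(\<lambda>\<omega>. infdist x (A \<omega>)) \<in> borel_measurable M" for x
  proof -
    have "(\<lambda>\<omega>. real_of_ereal (liminf (\<lambda>m. INF k. ereal (dist x (g m k \<omega>))))) \<in> borel_measurable M"
      by measurable
    then show ?thesis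
      by (rule measurable_cong[THEN iffD1, rotated]) (simp add: key[symmetric])
  qed
  then show ?thesis
    using A closed_limit_set unfolding random_set_def A_def by blast
qed

text \<open>The limit set of \<open>F\<close> belongs to \<open>\<D>\<close> as a random subset of \<open>F\<close>. It attracts every \<open>D\<close> in \<open>\<D>\<close>
  because the limit set of \<open>D\<close> is carried along by the invariance inside \<open>F\<close>.\<close>

theorem random_attractor_limit_set:
  assumes univ: "random_universe M \<D>" and att: "universe_attracting M \<theta> \<phi> \<D> F"
    and ac: "asymptotically_compact M \<theta> \<phi> \<D>"
  shows "random_attractor M \<theta> \<phi> \<D> (\<lambda>\<omega>. limit_set (pullback \<theta> \<phi> F \<omega>))"
proof -
  define A where "A \<omega> = limit_set (pullback \<theta> \<phi> F \<omega>)" for \<omega>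
  have FD: "F \<in> \<D>" using att by (simp add: universe_attracting_def)
  have rs: "random_set M D" if "D \<in> \<D>" for D using univ that by (simp add: random_universe_def)
  have pc: "asymptotically_precompact (pullback \<theta> \<phi> D \<omega>)" if "D \<in> \<D>" "\<omega> \<in> space M" for D \<omega>
    using ac that unfolding asymptotically_compact_iff_pullback by blast
  have ne: "pullback \<theta> \<phi> D \<omega> t \<noteq> {}" if "D \<in> \<D>" "\<omega> \<in> space M" for D \<omega> t
    using rs[OF that(1)] flow_in_space[OF that(2)] by (simp add: random_set_def pullback_def)
  have sub: "limit_set (pullback \<theta> \<phi> D \<omega>) \<subseteq> F \<omega>" if "D \<in> \<D>" "\<omega> \<in> space M" for D \<omega>
    using att rs[OF FD] that limit_set_subset_attracting
    unfolding universe_attracting_def attracts_iff_pullback random_set_def by blast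
  have rsA: "random_set M A"
    unfolding A_def by (rule random_set_limit_set[OF rs[OF FD] pc[OF FD] sub[OF FD]])
  have AD: "A \<in> \<D>"
    using univ FD rsA sub[OF FD] unfolding random_universe_def A_def by blast
  have absorb: "limit_set (pullback \<theta> \<phi> D \<omega>) \<subseteq> A \<omega>" if D: "D \<in> \<D>" and \<omega>: "\<omega> \<in> space M" for D \<omega>
  proof
    fix y assume y: "y \<in> limit_set (pullback \<theta> \<phi> D \<omega>)"
    \<comment> \<open>The constant sequence \<open>y\<close> then witnesses membership in the omega-limit set of \<open>F\<close>.\<close>
    have "y \<in> pullback \<theta> \<phi> F \<omega> (real n)" for n
    proof -
      let ?\<omega> = "\<theta> (- real n) \<omega>"
      have sp: "?\<omega> \<in> space M" by (rule flow_in_space[OF \<omega>])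
      have "\<theta> (real n) ?\<omega> = \<omega>"
        using flow_add[OF \<omega>, of "real n" "- real n"] flow_zero[OF \<omega>] by simp
      then have "\<phi> (real n) ?\<omega> ` limit_set (pullback \<theta> \<phi> D ?\<omega>) = limit_set (pullback \<theta> \<phi> D \<omega>)"
        using limit_set_invariant[OF sp _ pc[OF D], of "real n"] by simp
      with y sub[OF D sp] show ?thesis unfolding pullback_def by blast
    qed
    then show "y \<in> A \<omega>"
      unfolding A_def by (intro limit_setI[OF filterlim_real_sequentially _ tendsto_const])
  qed
  have "attracts M \<theta> \<phi> A D" if "D \<in> \<D>" for D
    unfolding attracts_iff_pullback
    using semidist_tendsto_0I[OF pc[OF that] absorb[OF that] ne[OF that]] by blast
  moreover have "\<phi> t \<omega> ` A \<omega> = A (\<theta> t \<omega>)" if "\<omega> \<in> space M" "t > 0" for t \<omega>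
    unfolding A_def using limit_set_invariant[OF that(1) _ pc[OF FD], of t] that(2) by simp
  moreover have "compact (A \<omega>)" if "\<omega> \<in> space M" for \<omega>
    unfolding A_def by (rule compact_limit_set[OF pc[OF FD that]])
  ultimately have "random_attractor M \<theta> \<phi> \<D> A"
    using rsA AD by (simp add: random_attractor_def universe_attracting_def compact_random_set_def)
  then show ?thesis unfolding A_def .
qed

end

section \<open>Existence of random attractors\<close>

lemma asymptotically_compact_of_random_attractor:
  assumes "random_attractor M \<theta> \<phi> \<D> A"
  shows "asymptotically_compact M \<theta> \<phi> \<D>"
  unfolding asymptotically_compact_iff_pullback
proof (intro ballI)
  fix \<omega> D assume \<omega>: "\<omega> \<in> space M" and D: "D \<in> \<D>"
  have "((\<lambda>t. semidist (pullback \<theta> \<phi> D \<omega> t) (A \<omega>)) \<longlongrightarrow> 0) at_top"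
    using assms \<omega> D
    by (simp add: random_attractor_def universe_attracting_def attracts_iff_pullback)
  moreover have "compact (A \<omega>)" "A \<omega> \<noteq> {}"
    using assms \<omega> by (simp_all add: random_attractor_def compact_random_set_def random_set_def)
  ultimately show "asymptotically_precompact (pullback \<theta> \<phi> D \<omega>)"
    by (rule asymptotically_precompact_of_compact_attracting)
qed

theorem theorem2p28:
  fixes M :: "'w measure"
    and \<theta> :: "real \<Rightarrow> 'w \<Rightarrow> 'w"
    and \<phi> :: "real \<Rightarrow> 'w \<Rightarrow> 'x::{banach, polish_space} \<Rightarrow> 'x"
    and \<tau> :: "'x topology"
    and \<D> :: "('w \<Rightarrow> 'x set) set"
  assumes "random_dynamical_system M \<theta> \<phi>"
    and "topspace \<tau> = UNIV"
    and "Hausdorff_space \<tau>"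
    and "\<And>U. openin \<tau> U \<Longrightarrow> open U"
    and "quasi_continuous M \<tau> \<phi>"
    and "random_universe M \<D>"
  shows "(\<exists>A. random_attractor M \<theta> \<phi> \<D> A) \<longleftrightarrow>
    (\<exists>F. bounded_random_set M F \<and> F \<in> \<D> \<and> universe_attracting M \<theta> \<phi> \<D> F) \<and>
    asymptotically_compact M \<theta> \<phi> \<D>"
proof
  assume "\<exists>A. random_attractor M \<theta> \<phi> \<D> A"
  then obtain A where A: "random_attractor M \<theta> \<phi> \<D> A" ..
  then have "bounded_random_set M A \<and> A \<in> \<D> \<and> universe_attracting M \<theta> \<phi> \<D> A"
    by (auto simp: random_attractor_def compact_random_set_def bounded_random_set_def
        intro: compact_imp_bounded)
  with asymptotically_compact_of_random_attractor[OF A]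
  show "(\<exists>F. bounded_random_set M F \<and> F \<in> \<D> \<and> universe_attracting M \<theta> \<phi> \<D> F) \<and>
    asymptotically_compact M \<theta> \<phi> \<D>" by blast
next
  interpret quasi_continuous_rds M \<theta> \<phi> \<tau>
    using assms(1-5) by (simp add: quasi_continuous_rds_def quasi_continuous_rds_axioms_def)
  assume "(\<exists>F. bounded_random_set M F \<and> F \<in> \<D> \<and> universe_attracting M \<theta> \<phi> \<D> F) \<and>
    asymptotically_compact M \<theta> \<phi> \<D>"
  then show "\<exists>A. random_attractor M \<theta> \<phi> \<D> A"
    using random_attractor_limit_set[OF assms(6)] by blast
qed

end
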